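(* Let $L, R$ be non-empty subsets of a group $G$ with identity $e$, such that $G=N_G(L)N_G(R)$. Then $(L,R)$ has the $2$S-Cayley property if and only if the following all hold: $(1')$ $L^{-1}R=LR^{-1}$; $(2')$ $L\cap R=\varnothing$; $(3')$ $L^{-1}L\cap R^{-1}R=\{e\}$.
   Context: For subsets $X,Y$ of a group $G$ and $g\in G$ write $X^{-1}=\{x^{-1}: x\in X\}$, $X^g=g^{-1}Xg$, $XY=\{xy: x\in X, y\in Y\}$, and $N_G(X)=\{g\in G: Xg=gX\}$. A pair $(L,R)$ of subsets of $G$ has the $2$S-Cayley property if both $L,R$ are non-empty and: (1) $L^{-1}gR=LgR^{-1}$ for each $g\in G$; (2) $L^g\cap R=\varnothing$ for each $g\in G$; (3) $(LL^{-1})^g\cap (RR^{-1})=\{e\}$ for each $g\in G$. *)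

theory Defs
  imports "HOL-Algebra.Group_Action"
begin

definition conj_set :: "('a, 'b) monoid_scheme \<Rightarrow> 'a set \<Rightarrow> 'a \<Rightarrow> 'a set" where
  "conj_set G X g = inv\<^bsub>G\<^esub> g <#\<^bsub>G\<^esub> X #>\<^bsub>G\<^esub> g"

text \<open>The elements with \<open>Xg = gX\<close>, for an arbitrary subset \<open>X\<close> of the group. This is the
  library's \<^const>\<open>normalizer\<close>, which is phrased as a stabilizer under conjugation; see the
  lemma below.\<close>

definition set_normalizer :: "('a, 'b) monoid_scheme \<Rightarrow> 'a set \<Rightarrow> 'a set" where
  "set_normalizer G X = {g \<in> carrier G. X #>\<^bsub>G\<^esub> g = g <#\<^bsub>G\<^esub> X}"

lemma (in group) set_normalizer_eq_normalizer:
  assumes X: "X \<subseteq> carrier G"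
  shows "set_normalizer G X = normalizer G X"
proof -
  have "X #> g = g <# X \<longleftrightarrow> g <# X #> inv g = X" if g: "g \<in> carrier G" for g
  proof
    assume "X #> g = g <# X"
    then have "g <# X #> inv g = X #> g #> inv g" by simp
    also have "\<dots> = X"
      using X g by (simp add: coset_mult_assoc)
    finally show "g <# X #> inv g = X" .
  next
    assume "g <# X #> inv g = X"
    then have "X #> g = g <# X #> inv g #> g" by simp
    also have "\<dots> = g <# X"
      using X g l_coset_subset_G[OF X g] by (simp add: coset_mult_assoc)
    finally show "X #> g = g <# X" .
  qed
  then show ?thesis
    using X by (auto simp: set_normalizer_def normalizer_def stabilizer_def)
qed

definition two_S_Cayley :: "('a, 'b) monoid_scheme \<Rightarrow> 'a set \<Rightarrow> 'a set \<Rightarrow> bool" where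
  "two_S_Cayley G L R \<longleftrightarrow>
     L \<subseteq> carrier G \<and> R \<subseteq> carrier G \<and> L \<noteq> {} \<and> R \<noteq> {} \<and>
     (\<forall>g\<in>carrier G.
        set_inv\<^bsub>G\<^esub> L #>\<^bsub>G\<^esub> g <#>\<^bsub>G\<^esub> R = L #>\<^bsub>G\<^esub> g <#>\<^bsub>G\<^esub> set_inv\<^bsub>G\<^esub> R) \<and>
     (\<forall>g\<in>carrier G. conj_set G L g \<inter> R = {}) \<and>
     (\<forall>g\<in>carrier G.
        conj_set G (L <#>\<^bsub>G\<^esub> set_inv\<^bsub>G\<^esub> L) g \<inter> (R <#>\<^bsub>G\<^esub> set_inv\<^bsub>G\<^esub> R) = {\<one>\<^bsub>G\<^esub>})"

end

theory Submission
  imports Defs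
begin

text \<open>
  Write \<open>g = n m\<close> with \<open>n\<close> normalizing \<open>L\<close> and \<open>m\<close> normalizing \<open>R\<close>. In each of the three
  conditions \<open>n\<close> moves through \<open>L\<close> to the far left and \<open>m\<close> through \<open>R\<close> to the far right, so that
  every condition at \<open>g\<close> is a translate or a conjugate of the condition at the identity:
  \<open>L\<inverse>gR = n(L\<inverse>R)m\<close> and \<open>LgR\<inverse> = n(LR\<inverse>)m\<close> (lemma \<open>translate_product_normalizer\<close>), and
  \<open>X\<^sup>g \<inter> Y = (X \<inter> Y)\<^sup>m\<close> for \<open>(X, Y)\<close> equal to \<open>(L, R)\<close> or to \<open>(L\<inverse>L, R\<inverse>R)\<close>
  (lemma \<open>conj_set_Int_normalizer\<close>).

  What remains is the passage from the quotients \<open>LL\<inverse>\<close>, \<open>RR\<inverse>\<close> of the third condition to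
  \<open>L\<inverse>L\<close>, \<open>R\<inverse>R\<close>. Since \<open>ab\<inverse>\<close> and \<open>b\<inverse>a\<close> are conjugate by \<open>a\<close>, a nontrivial
  element of \<open>LL\<inverse>\<close> is conjugate to one of \<open>RR\<inverse>\<close> exactly if the same holds for
  \<open>L\<inverse>L\<close> and \<open>R\<inverse>R\<close>. This holds in every group, once \<^emph>\<open>all\<close> conjugates are
  considered (lemma \<open>conj_quotients_trivial_iff\<close>).
\<close>

context group
begin

lemma cancel_inv_left:
  assumes "x \<in> carrier G" "y \<in> carrier G"
  shows "inv x \<otimes> (x \<otimes> y) = y" and "x \<otimes> (inv x \<otimes> y) = y"
  using assms by (simp_all flip: m_assoc)

lemma conj_set_eq_image: "conj_set G X g = (\<lambda>x. inv g \<otimes> x \<otimes> g) ` X"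
  by (auto simp: conj_set_def l_coset_def r_coset_def)

lemma conj_set_closed:
  assumes "X \<subseteq> carrier G" "g \<in> carrier G"
  shows "conj_set G X g \<subseteq> carrier G"
  using assms by (auto simp: conj_set_eq_image)

lemma conj_set_one: "X \<subseteq> carrier G \<Longrightarrow> conj_set G X \<one> = X"
  by (simp add: conj_set_def coset_join3 lcos_mult_one)

lemma conj_set_mult:
  assumes "X \<subseteq> carrier G" "n \<in> carrier G" "m \<in> carrier G"
  shows "conj_set G X (n \<otimes> m) = conj_set G (conj_set G X n) m"
  unfolding conj_set_eq_image image_image
  using assms by (intro image_cong) (auto simp: inv_mult_group m_assoc subset_iff)

lemma conj_set_Int:
  assumes "X \<subseteq> carrier G" "Y \<subseteq> carrier G" "g \<in> carrier G"
  shows "conj_set G (X \<inter> Y) g = conj_set G X g \<inter> conj_set G Y g"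
  unfolding conj_set_eq_image
proof (rule inj_on_image_Int)
  show "inj_on (\<lambda>x. inv g \<otimes> x \<otimes> g) (carrier G)"
    using assms(3) by (auto intro!: inj_onI)
qed (use assms in auto)

lemma conj_set_set_inv:
  assumes "X \<subseteq> carrier G" "g \<in> carrier G"
  shows "conj_set G (set_inv X) g = set_inv (conj_set G X g)"
proof -
  have "inv (inv g \<otimes> x \<otimes> g) = inv g \<otimes> inv x \<otimes> g" if "x \<in> X" for x
    using that assms by (auto simp: inv_mult_group m_assoc subset_iff)
  then show ?thesis
    by (auto simp: conj_set_eq_image SET_INV_def)
qed

lemma conj_set_set_mult:
  assumes "X \<subseteq> carrier G" "Y \<subseteq> carrier G" "g \<in> carrier G"
  shows "conj_set G (X <#> Y) g = conj_set G X g <#> conj_set G Y g"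
proof -
  have "inv g \<otimes> (x \<otimes> y) \<otimes> g = (inv g \<otimes> x \<otimes> g) \<otimes> (inv g \<otimes> y \<otimes> g)"
    if "x \<in> X" "y \<in> Y" for x y
  proof -
    have "x \<in> carrier G" "y \<in> carrier G" using that assms by auto
    then show ?thesis using assms(3) by (simp add: m_assoc cancel_inv_left)
  qed
  then have "conj_set G (X <#> Y) g =
      (\<Union>x\<in>X. \<Union>y\<in>Y. {(inv g \<otimes> x \<otimes> g) \<otimes> (inv g \<otimes> y \<otimes> g)})"
    unfolding conj_set_eq_image set_mult_def image_UN by simp
  then show ?thesis
    by (simp add: conj_set_eq_image set_mult_def)
qed

lemma set_inv_closed: "X \<subseteq> carrier G \<Longrightarrow> set_inv X \<subseteq> carrier G"
  by (auto simp: SET_INV_def)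

lemma set_inv_set_inv: "X \<subseteq> carrier G \<Longrightarrow> set_inv (set_inv X) = X"
  by (force simp: SET_INV_def)

text \<open>Normalizing is being fixed by conjugation, and conjugation commutes with products and
  inverses; this is why whatever normalizes \<open>L\<close> also normalizes \<open>L\<inverse>\<close> and
  \<open>L\<inverse>L\<close>.\<close>

lemma set_normalizer_iff_conj_set:
  assumes X: "X \<subseteq> carrier G"
  shows "g \<in> set_normalizer G X \<longleftrightarrow> g \<in> carrier G \<and> conj_set G X g = X"
proof -
  have "X #> g = g <# X \<longleftrightarrow> inv g <# X #> g = X" if g: "g \<in> carrier G"
  proof
    assume "X #> g = g <# X"
    then have "inv g <# (X #> g) = X"
      using X g by (simp add: lcos_m_assoc lcos_mult_one)
    then show "inv g <# X #> g = X"
      using X g by (simp add: coset_assoc)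
  next
    assume "inv g <# X #> g = X"
    then have "g <# X = g <# (inv g <# (X #> g))"
      using X g by (simp add: coset_assoc)
    then show "X #> g = g <# X"
      using X g r_coset_subset_G[OF X g] by (simp add: lcos_m_assoc lcos_mult_one)
  qed
  then show ?thesis
    by (auto simp: set_normalizer_def conj_set_def)
qed

lemma set_normalizer_set_inv:
  assumes "X \<subseteq> carrier G" "g \<in> set_normalizer G X"
  shows "g \<in> set_normalizer G (set_inv X)"
  using assms by (simp add: set_normalizer_iff_conj_set set_inv_closed conj_set_set_inv)

lemma set_normalizer_set_mult:
  assumes "X \<subseteq> carrier G" "Y \<subseteq> carrier G"
    and "g \<in> set_normalizer G X" "g \<in> set_normalizer G Y"
  shows "g \<in> set_normalizer G (X <#> Y)"
  using assms by (simp add: set_normalizer_iff_conj_set set_mult_closed conj_set_set_mult)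

text \<open>The factor \<open>n\<close> fixes \<open>X\<close>, hence \<open>X\<^sup>n\<^sup>m = X\<^sup>m\<close>; as \<open>Y = Y\<^sup>m\<close>, both sets are conjugates by
  the same element.\<close>

lemma conj_set_Int_normalizer:
  assumes "X \<subseteq> carrier G" "Y \<subseteq> carrier G"
    and "n \<in> set_normalizer G X" "m \<in> set_normalizer G Y"
  shows "conj_set G X (n \<otimes> m) \<inter> Y = conj_set G (X \<inter> Y) m"
  using assms by (simp add: set_normalizer_iff_conj_set conj_set_mult conj_set_Int)

lemma translate_product_normalizer:
  assumes X: "X \<subseteq> carrier G" and Y: "Y \<subseteq> carrier G"
    and n: "n \<in> set_normalizer G X" and m: "m \<in> set_normalizer G Y"
  shows "X #> (n \<otimes> m) <#> Y = n <# (X <#> Y) #> m"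
proof -
  have nc: "n \<in> carrier G" and Xn: "X #> n = n <# X"
    and mc: "m \<in> carrier G" and Ym: "Y #> m = m <# Y"
    using n m by (auto simp: set_normalizer_def)
  note nX = l_coset_subset_G[OF X nc]
  have "X #> (n \<otimes> m) <#> Y = n <# X #> m <#> Y"
    using X nc mc by (simp flip: Xn add: coset_mult_assoc)
  also have "\<dots> = (n <# X) <#> (Y #> m)"
    using rcos_assoc_lcos[OF nX Y mc] by (simp add: Ym)
  also have "\<dots> = (n <# X) <#> Y #> m"
    using setmult_rcos_assoc[OF nX Y mc] .
  also have "(n <# X) <#> Y = n <# (X <#> Y)"
    using setmult_lcos_assoc[OF X Y nc] by simp
  finally show ?thesis .
qed

text \<open>If \<open>b\<inverse>a\<close> is taken to \<open>d\<inverse>c\<close> by conjugation with \<open>g\<close>, then \<open>ab\<inverse>\<close> is taken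
  to \<open>cd\<inverse>\<close> by conjugation with \<open>agc\<inverse>\<close>. Replacing \<open>L\<close> and \<open>R\<close> by
  \<open>L\<inverse>\<close> and \<open>R\<inverse>\<close> exchanges hypothesis and conclusion, so the lemma also
  gives its own converse.\<close>

lemma conj_quotients_trivial:
  assumes L: "L \<subseteq> carrier G" and R: "R \<subseteq> carrier G"
    and triv: "\<And>g. g \<in> carrier G \<Longrightarrow>
      conj_set G (L <#> set_inv L) g \<inter> (R <#> set_inv R) \<subseteq> {\<one>}"
    and g: "g \<in> carrier G"
  shows "conj_set G (set_inv L <#> L) g \<inter> (set_inv R <#> R) \<subseteq> {\<one>}"
proof
  fix x assume "x \<in> conj_set G (set_inv L <#> L) g \<inter> (set_inv R <#> R)"
  then obtain a b c d where mem: "a \<in> L" "b \<in> L" "c \<in> R" "d \<in> R"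
    and xL: "x = inv g \<otimes> (inv b \<otimes> a) \<otimes> g" and xR: "x = inv d \<otimes> c"
    by (auto simp: conj_set_eq_image set_mult_def SET_INV_def)
  have cl [simp]: "a \<in> carrier G" "b \<in> carrier G" "c \<in> carrier G" "d \<in> carrier G"
    using mem L R by auto
  let ?h = "a \<otimes> g \<otimes> inv c"
  have h: "?h \<in> carrier G" using g by simp
  have "inv ?h \<otimes> (a \<otimes> inv b) \<otimes> ?h = c \<otimes> x \<otimes> inv c"
    using g unfolding xL by (simp add: inv_mult_group m_assoc cancel_inv_left)
  also have "\<dots> = c \<otimes> inv d"
    unfolding xR by (simp add: m_assoc)
  finally have "c \<otimes> inv d \<in> conj_set G (L <#> set_inv L) ?h"
    using mem by (force simp: conj_set_eq_image set_mult_def SET_INV_def)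
  moreover have "c \<otimes> inv d \<in> R <#> set_inv R"
    using mem by (auto simp: set_mult_def SET_INV_def)
  ultimately have "c \<otimes> inv d = \<one>"
    using triv[OF h] by blast
  then have "c = d"
    by (metis cl(3,4) inv_closed inv_equality inv_inv)
  then show "x \<in> {\<one>}"
    by (simp add: xR)
qed

lemma one_in_quotients:
  assumes "X \<subseteq> carrier G" "X \<noteq> {}"
  shows "\<one> \<in> X <#> set_inv X" and "\<one> \<in> set_inv X <#> X"
proof -
  obtain x where "x \<in> X" "x \<in> carrier G" using assms by blast
  then show "\<one> \<in> X <#> set_inv X" "\<one> \<in> set_inv X <#> X"
    by (auto simp: set_mult_def SET_INV_def intro!: bexI[of _ x])
qed

lemma one_in_conj_set:
  assumes "\<one> \<in> X" "g \<in> carrier G"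
  shows "\<one> \<in> conj_set G X g"
  using assms by (auto simp: conj_set_eq_image intro!: image_eqI[of _ _ \<one>])

lemma conj_quotients_trivial_iff:
  assumes L: "L \<subseteq> carrier G" "L \<noteq> {}" and R: "R \<subseteq> carrier G" "R \<noteq> {}"
  shows "(\<forall>g\<in>carrier G. conj_set G (L <#> set_inv L) g \<inter> (R <#> set_inv R) = {\<one>}) \<longleftrightarrow>
    (\<forall>g\<in>carrier G. conj_set G (set_inv L <#> L) g \<inter> (set_inv R <#> R) = {\<one>})"
    (is "(\<forall>g\<in>carrier G. ?P g = _) \<longleftrightarrow> (\<forall>g\<in>carrier G. ?Q g = _)")
proof -
  have "\<one> \<in> ?P g" "\<one> \<in> ?Q g" if "g \<in> carrier G" for g
    using that one_in_quotients[OF L] one_in_quotients[OF R] by (simp_all add: one_in_conj_set)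
  then have eq_iff: "?P g = {\<one>} \<longleftrightarrow> ?P g \<subseteq> {\<one>}" "?Q g = {\<one>} \<longleftrightarrow> ?Q g \<subseteq> {\<one>}"
    if "g \<in> carrier G" for g
    using that by blast+
  have "?Q g \<subseteq> {\<one>}" if "\<And>g. g \<in> carrier G \<Longrightarrow> ?P g \<subseteq> {\<one>}" "g \<in> carrier G" for g
    using conj_quotients_trivial[OF L(1) R(1)] that by blast
  moreover have "?P g \<subseteq> {\<one>}" if "\<And>g. g \<in> carrier G \<Longrightarrow> ?Q g \<subseteq> {\<one>}" "g \<in> carrier G" for g
    using conj_quotients_trivial[OF set_inv_closed[OF L(1)] set_inv_closed[OF R(1)], of g] that
    by (simp add: set_inv_set_inv L R)
  ultimately show ?thesis
    by (simp add: eq_iff) blast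
qed

end

theorem proposition5p3:
  fixes G :: "('a, 'b) monoid_scheme" and L R :: "'a set"
  assumes "group G"
    and "L \<subseteq> carrier G" and "R \<subseteq> carrier G"
    and "L \<noteq> {}" and "R \<noteq> {}"
    and "carrier G = set_normalizer G L <#>\<^bsub>G\<^esub> set_normalizer G R"
  shows "two_S_Cayley G L R \<longleftrightarrow>
     set_inv\<^bsub>G\<^esub> L <#>\<^bsub>G\<^esub> R = L <#>\<^bsub>G\<^esub> set_inv\<^bsub>G\<^esub> R \<and>
     L \<inter> R = {} \<and>
     (set_inv\<^bsub>G\<^esub> L <#>\<^bsub>G\<^esub> L) \<inter> (set_inv\<^bsub>G\<^esub> R <#>\<^bsub>G\<^esub> R) = {\<one>\<^bsub>G\<^esub>}"
proof -
  interpret group G by fact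
  note L = assms(2) and R = assms(3)
  note L' = set_inv_closed[OF L] and R' = set_inv_closed[OF R]
  note LL = set_mult_closed[OF L' L] and RR = set_mult_closed[OF R' R]
  have factor: "\<exists>n\<in>set_normalizer G L. \<exists>m\<in>set_normalizer G R. g = n \<otimes>\<^bsub>G\<^esub> m"
    if "g \<in> carrier G" for g
    using that assms(6) by (auto simp: set_mult_def)

  have "(\<forall>g\<in>carrier G. set_inv\<^bsub>G\<^esub> L #>\<^bsub>G\<^esub> g <#>\<^bsub>G\<^esub> R = L #>\<^bsub>G\<^esub> g <#>\<^bsub>G\<^esub> set_inv\<^bsub>G\<^esub> R) \<longleftrightarrow>
      set_inv\<^bsub>G\<^esub> L <#>\<^bsub>G\<^esub> R = L <#>\<^bsub>G\<^esub> set_inv\<^bsub>G\<^esub> R" (is "?C1 \<longleftrightarrow> ?D1")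
  proof
    assume ?C1
    from bspec[OF this one_closed] show ?D1
      by (simp add: L L')
  next
    assume D: ?D1
    show ?C1
    proof
      fix g assume "g \<in> carrier G"
      then obtain n m where nm: "n \<in> set_normalizer G L" "m \<in> set_normalizer G R"
        and g: "g = n \<otimes>\<^bsub>G\<^esub> m" using factor by blast
      show "set_inv\<^bsub>G\<^esub> L #>\<^bsub>G\<^esub> g <#>\<^bsub>G\<^esub> R = L #>\<^bsub>G\<^esub> g <#>\<^bsub>G\<^esub> set_inv\<^bsub>G\<^esub> R"
        unfolding g
        using translate_product_normalizer[OF L' R set_normalizer_set_inv[OF L nm(1)] nm(2)]
          translate_product_normalizer[OF L R' nm(1) set_normalizer_set_inv[OF R nm(2)]] D
        by simp
    qed
  qed
  moreover have "(\<forall>g\<in>carrier G. conj_set G L g \<inter> R = {}) \<longleftrightarrow> L \<inter> R = {}" (is "?C2 \<longleftrightarrow> ?D2")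
  proof
    assume ?C2
    from bspec[OF this one_closed] show ?D2
      by (simp add: conj_set_one L)
  next
    assume D: ?D2
    show ?C2
    proof
      fix g assume "g \<in> carrier G"
      then obtain n m where nm: "n \<in> set_normalizer G L" "m \<in> set_normalizer G R"
        and g: "g = n \<otimes>\<^bsub>G\<^esub> m" using factor by blast
      show "conj_set G L g \<inter> R = {}"
        unfolding g conj_set_Int_normalizer[OF L R nm] by (simp add: D conj_set_eq_image)
    qed
  qed
  moreover have "(\<forall>g\<in>carrier G. conj_set G (set_inv\<^bsub>G\<^esub> L <#>\<^bsub>G\<^esub> L) g \<inter>
        (set_inv\<^bsub>G\<^esub> R <#>\<^bsub>G\<^esub> R) = {\<one>\<^bsub>G\<^esub>}) \<longleftrightarrow>
      (set_inv\<^bsub>G\<^esub> L <#>\<^bsub>G\<^esub> L) \<inter> (set_inv\<^bsub>G\<^esub> R <#>\<^bsub>G\<^esub> R) = {\<one>\<^bsub>G\<^esub>}" (is "?C3 \<longleftrightarrow> ?D3")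
  proof
    assume ?C3
    from bspec[OF this one_closed] show ?D3
      by (simp add: conj_set_one LL)
  next
    assume D: ?D3
    show ?C3
    proof
      fix g assume "g \<in> carrier G"
      then obtain n m where nm: "n \<in> set_normalizer G L" "m \<in> set_normalizer G R"
        and g: "g = n \<otimes>\<^bsub>G\<^esub> m" using factor by blast
      have n: "n \<in> set_normalizer G (set_inv\<^bsub>G\<^esub> L <#>\<^bsub>G\<^esub> L)"
        and m: "m \<in> set_normalizer G (set_inv\<^bsub>G\<^esub> R <#>\<^bsub>G\<^esub> R)"
        using set_normalizer_set_mult set_normalizer_set_inv L R L' R' nm by blast+
      have "m \<in> carrier G" using nm(2) by (simp add: set_normalizer_def)
      then show "conj_set G (set_inv\<^bsub>G\<^esub> L <#>\<^bsub>G\<^esub> L) g \<inter> (set_inv\<^bsub>G\<^esub> R <#>\<^bsub>G\<^esub> R) = {\<one>\<^bsub>G\<^esub>}"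
        unfolding g conj_set_Int_normalizer[OF LL RR n m] by (simp add: D conj_set_eq_image)
    qed
  qed
  ultimately show ?thesis
    using assms(2-5) conj_quotients_trivial_iff[OF L assms(4) R assms(5)]
    by (simp add: two_S_Cayley_def)
qed

end
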